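(* Let $q$ be a prime power and $m\ge2$, $\ell\ge1$ integers with $\ell\mid m$, $\ell<m$ and $m/\ell$ even. Then the complement $\bar\Gamma_{q,m}(\ell)$ of $\Gamma_{q,m}(\ell)$ is a Ramanujan graph.
   Context: For a prime power $q$ and integers $m\ge1,\ell\ge0$, $S_{q,m}(\ell)=\{x^{q^\ell+1}:x\in\mathbb F_{q^m}^*\}$ and $\Gamma_{q,m}(\ell)$ is the Cayley graph on $\mathbb F_{q^m}$ with $x\sim y$ iff $y-x\in S_{q,m}(\ell)$; $\bar\Gamma_{q,m}(\ell)$ is its complement. A $k$-regular simple connected graph with adjacency eigenvalues $\lambda_1,\dots,\lambda_n$ is Ramanujan if $\max\{|\lambda_i| : |\lambda_i|\ne k\}\le 2\sqrt{k-1}$. *)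

theory Defs
  imports
    "Graph_Theory.Digraph_Component"
    "Jordan_Normal_Form.Char_Poly"
    "HOL-Number_Theory.Prime_Powers"
begin

text \<open>
  Graphs are the symmetric, loop-free finite digraphs (\<open>pair_graph\<close>) of
  \<open>Graph_Theory\<close>.  The two constructions below make sense for an arbitrary connection
  set or digraph; that the result is a simple graph is part of \<open>ramanujan_graph\<close>.
\<close>

definition cayley_graph :: "'a::ab_group_add set \<Rightarrow> 'a pair_pre_digraph" where
  "cayley_graph S = \<lparr> pverts = UNIV, parcs = {(x, y). y - x \<in> S} \<rparr>"

definition graph_complement :: "'a pair_pre_digraph \<Rightarrow> 'a pair_pre_digraph" where
  "graph_complement G = \<lparr> pverts = pverts G,
     parcs = {(x, y). x \<in> pverts G \<and> y \<in> pverts G \<and> x \<noteq> y \<and> (x, y) \<notin> parcs G} \<rparr>"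

text \<open>
  \<open>Jordan_Normal_Form\<close> indexes matrices by natural numbers, so the adjacency matrix is
  taken with respect to a listing \<open>vs\<close> of the vertices.  Different listings give similar
  matrices.  Eigenvalues are sought among all complex numbers.
\<close>

definition adjacency_matrix :: "'a pair_pre_digraph \<Rightarrow> 'a list \<Rightarrow> complex mat" where
  "adjacency_matrix G vs =
     mat (length vs) (length vs) (\<lambda>(i, j). if (vs ! i, vs ! j) \<in> parcs G then 1 else 0)"

definition adjacency_eigenvalue :: "'a pair_pre_digraph \<Rightarrow> complex \<Rightarrow> bool" where
  "adjacency_eigenvalue G \<mu> \<longleftrightarrow>
     (\<exists>vs. distinct vs \<and> set vs = pverts G \<and> eigenvalue (adjacency_matrix G vs) \<mu>)"

definition regular_graph :: "'a pair_pre_digraph \<Rightarrow> nat \<Rightarrow> bool" where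
  "regular_graph G k \<longleftrightarrow> (\<forall>v\<in>pverts G. out_degree (with_proj G) v = k)"

text \<open>
  The bound on the maximum is stated for each eigenvalue of modulus different from \<open>k\<close>, so
  that it holds vacuously when there is none.  \<open>Digraph_Component.connected\<close> includes
  that the vertex set is nonempty, hence \<open>k\<close> is unique.
\<close>

definition ramanujan_graph :: "'a pair_pre_digraph \<Rightarrow> bool" where
  "ramanujan_graph G \<longleftrightarrow>
     pair_graph G \<and> Digraph_Component.connected (with_proj G) \<and>
     (\<exists>k. regular_graph G k \<and>
          (\<forall>\<mu>. adjacency_eigenvalue G \<mu> \<and> cmod \<mu> \<noteq> real k \<longrightarrow>
                cmod \<mu> \<le> 2 * sqrt (real k - 1)))"

text \<open>
  The field with \<open>q ^ m\<close> elements is a finite field type of that cardinality, so \<open>m\<close> is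
  carried by the type rather than by an argument.
\<close>

definition connection_set :: "nat \<Rightarrow> nat \<Rightarrow> 'a::{field, finite} set" where
  "connection_set q l = {x ^ (q ^ l + 1) | x. x \<noteq> 0}"

definition Gamma_graph :: "nat \<Rightarrow> nat \<Rightarrow> 'a::{field, finite} pair_pre_digraph" where
  "Gamma_graph q l = cayley_graph (connection_set q l)"

end

theory Submission
  imports Defs
begin

text \<open>
  The complement is the Cayley graph of \<open>D = - (S \<union> {0})\<close>, so each of its eigenvalues is
  \<open>\<mu> = (\<Sum>d\<in>D. \<chi> d)\<close> for an additive character \<open>\<chi>\<close>.  Put \<open>Q = q ^ l\<close> and let \<open>n = Q ^ (2 * t)\<close>
  be the order of the field.  Since \<open>m div l\<close> is even, \<open>Q + 1\<close> divides \<open>n - 1\<close>, so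
  \<open>x \<mapsto> x ^ (Q + 1)\<close> is \<open>(Q + 1)\<close>-to-one onto \<open>S\<close>; for nontrivial \<open>\<chi>\<close> this gives
  \<open>(Q + 1) * \<mu> = - (Q + \<theta>)\<close> with \<open>\<theta> = (\<Sum>z. \<chi> (z ^ (Q + 1)))\<close>.
  Expanding \<open>\<theta> * cnj \<theta>\<close> and substituting \<open>z = w + h\<close> leaves \<open>n\<close> times a character sum over the
  radical \<open>K\<close> of the form \<open>(w, h) \<mapsto> \<chi> (w ^ Q * h + w * h ^ Q)\<close>.  As \<open>K\<close> has at most \<open>Q\<^sup>2\<close>
  elements, \<open>\<bar>\<theta>\<bar> \<le> Q ^ (t + 1)\<close>, and this bound suffices (with equality for \<open>Q = 2\<close>, \<open>t = 1\<close>).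
\<close>

section \<open>Simultaneous eigenfunctions of translations\<close>

lemma sum_const_card_eq_zero:
  fixes g :: "'a::{ab_group_add, finite}"
  shows "(\<Sum>i<card (UNIV :: 'a set). g) = 0"
proof -
  obtain b where b: "bij_betw b {..<card (UNIV :: 'a set)} (UNIV :: 'a set)"
    using ex_bij_betw_nat_finite[of "UNIV :: 'a set"] by (auto simp: atLeast0LessThan)
  have "(\<Sum>x\<in>(UNIV :: 'a set). x + g) = (\<Sum>x\<in>UNIV. x)"
    by (rule sum.reindex_bij_witness[of _ "\<lambda>x. x - g" "\<lambda>x. x + g"]) auto
  hence "(\<Sum>x\<in>(UNIV :: 'a set). g) = 0"
    by (simp add: sum.distrib)
  thus ?thesis
    using sum.reindex_bij_betw[OF b, of "\<lambda>_. g"] by simp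
qed

text \<open>A discrete Fourier projection along the multiples of \<open>g\<close>. The explicit sum
  belongs to the conclusion because a combination of translates of \<open>f\<close> inherits the
  eigenvalue relations of \<open>f\<close> with translation-invariant operators.\<close>

lemma translation_eigenfunction_extend:
  fixes f :: "'a::{ab_group_add, finite} \<Rightarrow> complex" and g :: 'a
  assumes "f x0 \<noteq> 0"
  obtains \<zeta> c h where "\<And>x. h x = (\<Sum>i<card (UNIV :: 'a set). \<zeta> ^ i * f (x + c i))"
    "h x0 \<noteq> 0" "\<And>x. h (x + g) = inverse \<zeta> * h x"
proof -
  define n where "n = card (UNIV :: 'a set)"
  have n: "n > 0" by (simp add: n_def card_gt_0_iff)
  define c where "c i = (\<Sum>j<i. g)" for i :: nat
  \<comment> \<open>If no projection of \<open>f\<close> to an eigenspace of translation by \<open>g\<close> survived at \<open>x0\<close>, then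
    \<open>p\<close> of degree below \<open>n\<close> would vanish at all \<open>n\<close>-th roots of unity.\<close>
  define p where "p = (\<Sum>i<n. monom (f (x0 + c i)) i)"
  have "coeff p 0 = f x0"
    using n by (simp add: p_def coeff_sum c_def if_distrib cong: if_cong)
  hence "p \<noteq> 0" using assms by auto
  have deg: "degree p < n"
    using n unfolding p_def
    by (intro degree_sum_less) (auto intro: le_less_trans[OF degree_monom_le])
  have "\<not> (\<forall>\<zeta>\<in>{z. z ^ n = 1}. poly p \<zeta> = poly 0 \<zeta>)"
    using \<open>p \<noteq> 0\<close> deg n poly_eqI_degree[of "{z. z ^ n = 1}" p 0] card_roots_unity_eq[of n]
    by auto
  then obtain \<zeta> where \<zeta>: "\<zeta> ^ n = 1" "poly p \<zeta> \<noteq> 0" by auto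
  define h where "h x = (\<Sum>i<n. \<zeta> ^ i * f (x + c i))" for x
  have "h x0 = poly p \<zeta>"
    by (simp add: h_def p_def poly_sum poly_monom mult.commute)
  moreover have "h (x + g) = inverse \<zeta> * h x" for x
  proof -
    have \<zeta>0: "\<zeta> \<noteq> 0" using \<zeta>(1) n by (auto simp: power_0_left)
    \<comment> \<open>Multiplying by \<zeta> shifts the index by one; the shifted sum closes up
      since \<open>\<zeta> ^ n = 1\<close> and \<open>c n = c 0\<close>.\<close>
    have "\<zeta> * h (x + g) = (\<Sum>i<n. \<zeta> ^ Suc i * f (x + c (Suc i)))"
      by (simp add: h_def sum_distrib_left c_def algebra_simps)
    also have "\<dots> + \<zeta> ^ 0 * f (x + c 0) = (\<Sum>i<Suc n. \<zeta> ^ i * f (x + c i))"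
      by (subst sum.lessThan_Suc_shift) simp
    also have "\<dots> = h x + \<zeta> ^ n * f (x + c n)"
      by (simp add: h_def)
    also have "c n = c 0"
      by (simp add: c_def n_def sum_const_card_eq_zero)
    finally have "\<zeta> * h (x + g) = h x" using \<zeta>(1) by simp
    thus ?thesis using \<zeta>0 by (simp add: field_simps)
  qed
  ultimately show ?thesis
    using \<zeta>(2) by (intro that[of h \<zeta> c]) (auto simp: h_def n_def)
qed

text \<open>Summation over \<open>D\<close> commutes with all translations, and translations commute
  with each other. So projecting for a new \<open>g\<close> preserves the relations already gained,
  and \<open>G\<close> can be built up one element at a time.\<close>

lemma common_translation_eigenfunction:
  fixes f :: "'a::{ab_group_add, finite} \<Rightarrow> complex" and D :: "'a set"
  assumes "f x0 \<noteq> 0" and "\<And>x. (\<Sum>d\<in>D. f (x + d)) = \<mu> * f x"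
  shows "\<exists>h. h x0 \<noteq> 0 \<and> (\<forall>x. (\<Sum>d\<in>D. h (x + d)) = \<mu> * h x) \<and>
           (\<forall>g\<in>G. \<exists>\<zeta>. \<forall>x. h (x + g) = \<zeta> * h x)"
  using finite[of G]
proof (induction G rule: finite_induct)
  case empty
  thus ?case using assms by auto
next
  case (insert g G)
  then obtain h where h: "h x0 \<noteq> 0" "\<And>x. (\<Sum>d\<in>D. h (x + d)) = \<mu> * h x"
    "\<And>g. g \<in> G \<Longrightarrow> \<exists>\<zeta>. \<forall>x. h (x + g) = \<zeta> * h x" by blast
  obtain \<zeta> c k where k: "\<And>x. k x = (\<Sum>i<card (UNIV :: 'a set). \<zeta> ^ i * h (x + c i))"
    "k x0 \<noteq> 0" "\<And>x. k (x + g) = inverse \<zeta> * k x"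
    by (rule translation_eigenfunction_extend[of h x0 g, OF h(1)]) (rule that)
  have "(\<Sum>d\<in>D. k (x + d)) = \<mu> * k x" for x
  proof -
    have "(\<Sum>d\<in>D. k (x + d)) =
        (\<Sum>i<card (UNIV :: 'a set). \<zeta> ^ i * (\<Sum>d\<in>D. h ((x + c i) + d)))"
      unfolding k(1) sum_distrib_left by (subst sum.swap) (simp add: algebra_simps)
    also have "\<dots> = \<mu> * k x"
      by (simp only: h(2) k(1) sum_distrib_left mult_ac)
    finally show ?thesis .
  qed
  moreover have "\<exists>\<xi>. \<forall>x. k (x + g') = \<xi> * k x" if g': "g' \<in> G" for g'
  proof -
    obtain \<xi> where \<xi>: "\<And>x. h (x + g') = \<xi> * h x" using h(3)[OF g'] by blast
    have "k (x + g') = \<xi> * k x" for x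
    proof -
      have "k (x + g') = (\<Sum>i<card (UNIV :: 'a set). \<zeta> ^ i * h ((x + c i) + g'))"
        unfolding k(1) by (simp add: algebra_simps)
      also have "\<dots> = \<xi> * k x"
        by (simp only: \<xi> k(1) sum_distrib_left mult_ac)
      finally show ?thesis .
    qed
    thus ?thesis by blast
  qed
  ultimately show ?case using k(2,3) by blast
qed

section \<open>Additive characters of a finite abelian group\<close>

locale additive_character =
  fixes \<chi> :: "'a::{ab_group_add, finite} \<Rightarrow> complex"
  assumes add: "\<chi> (x + y) = \<chi> x * \<chi> y" and zero [simp]: "\<chi> 0 = 1"
begin

lemma minus_mult: "\<chi> (- x) * \<chi> x = 1"
  by (metis add zero add.left_inverse)

lemma norm_eq_1 [simp]: "cmod (\<chi> x) = 1"
proof -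
  have nz: "\<chi> y \<noteq> 0" for y using minus_mult[of y] by auto
  \<comment> \<open>Translating the product by \<open>x\<close> gains the factor
    \<open>\<chi> x ^ card UNIV\<close>, so \<open>\<chi> x\<close> is a root of unity.\<close>
  have "(\<Prod>y\<in>UNIV. \<chi> (y + x)) = (\<Prod>y\<in>UNIV. \<chi> y)"
    by (rule prod.reindex_bij_witness[of _ "\<lambda>y. y - x" "\<lambda>y. y + x"]) auto
  moreover have "(\<Prod>y\<in>(UNIV :: 'a set). \<chi> y) \<noteq> 0" using nz by simp
  ultimately have "\<chi> x ^ card (UNIV :: 'a set) = 1"
    by (simp add: add prod.distrib)
  hence "cmod (\<chi> x) ^ card (UNIV :: 'a set) = 1 ^ card (UNIV :: 'a set)"
    by (metis norm_power norm_one power_one)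
  thus ?thesis
    by (rule power_eq_imp_eq_base) (auto simp: card_gt_0_iff)
qed

lemma minus: "\<chi> (- x) = cnj (\<chi> x)"
proof -
  have "cnj (\<chi> x) * \<chi> x = 1"
    using complex_norm_square[of "\<chi> x"] by (simp add: mult.commute)
  thus ?thesis using minus_mult[of x]
    by (metis mult_cancel_right mult_zero_right zero_neq_one)
qed

lemma diff: "\<chi> (x - y) = \<chi> x * cnj (\<chi> y)"
  using add[of x "- y"] by (simp add: minus)

end

lemma additive_character_comp:
  assumes "additive_character \<chi>" and "\<And>x y. \<phi> (x + y) = \<phi> x + \<phi> y"
  shows "additive_character (\<lambda>x. \<chi> (\<phi> x))"
proof -
  interpret additive_character \<chi> by fact
  have "\<phi> 0 = 0" using assms(2)[of 0 0] by simp
  thus ?thesis by unfold_locales (simp_all add: assms(2) add)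
qed

lemma (in additive_character) sum_eq_0:
  assumes "\<chi> y \<noteq> 1"
  shows "(\<Sum>x\<in>UNIV. \<chi> x) = 0"
proof -
  have "(\<Sum>x\<in>UNIV. \<chi> (x + y)) = (\<Sum>x\<in>UNIV. \<chi> x)"
    by (rule sum.reindex_bij_witness[of _ "\<lambda>x. x - y" "\<lambda>x. x + y"]) auto
  hence "(\<Sum>x\<in>UNIV. \<chi> x) * \<chi> y = (\<Sum>x\<in>UNIV. \<chi> x)"
    by (simp add: add flip: sum_distrib_right)
  thus ?thesis using assms by simp
qed

section \<open>Eigenvalues of Cayley graphs as character sums\<close>

lemma character_sum_of_eigenfunction:
  fixes f :: "'a::{ab_group_add, finite} \<Rightarrow> complex"
  assumes "f x0 \<noteq> 0" and "\<And>x. (\<Sum>d\<in>D. f (x + d)) = \<mu> * f x"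
  obtains \<chi> where "additive_character \<chi>" "\<mu> = (\<Sum>d\<in>D. \<chi> d)"
proof -
  obtain h where h: "h x0 \<noteq> 0" "\<And>x. (\<Sum>d\<in>D. h (x + d)) = \<mu> * h x"
    "\<And>g. \<exists>\<zeta>. \<forall>x. h (x + g) = \<zeta> * h x"
    using common_translation_eigenfunction[OF assms, of UNIV] by blast
  \<comment> \<open>The translation eigenvalues, as a function of the shift, form the character;
    \<open>h 0\<close> cannot vanish, since otherwise \<open>h\<close> would vanish at
    \<open>x0\<close>.\<close>
  then obtain \<chi> where \<chi>: "\<And>g x. h (x + g) = \<chi> g * h x" by metis
  have h0: "h 0 \<noteq> 0" using \<chi>[of 0 x0] h(1) by auto
  have "additive_character \<chi>"
  proof
    show "\<chi> 0 = 1" using \<chi>[of 0 0] h0 by simp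
    fix x y
    have "\<chi> (x + y) * h 0 = h (x + y)"
      using \<chi>[of 0 "x + y"] by simp
    also have "\<dots> = \<chi> y * (\<chi> x * h 0)"
      using \<chi>[of x y] \<chi>[of 0 x] by simp
    finally have "\<chi> (x + y) * h 0 = (\<chi> x * \<chi> y) * h 0"
      by (simp only: mult_ac)
    thus "\<chi> (x + y) = \<chi> x * \<chi> y" using h0 by simp
  qed
  moreover have "\<mu> * h 0 = (\<Sum>d\<in>D. \<chi> d) * h 0"
    by (simp only: h(2)[symmetric] \<chi> sum_distrib_right)
  ultimately show ?thesis using h0 that by simp
qed

text \<open>Read along the listing \<open>vs\<close>, an eigenvector is a function on the group, and
  the adjacency matrix acts on it by summing over the shifts in \<open>D\<close>.\<close>

lemma cayley_graph_eigenvalue: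
  fixes D :: "'a::{ab_group_add, finite} set"
  assumes "adjacency_eigenvalue (cayley_graph D) \<mu>"
  obtains \<chi> where "additive_character \<chi>" "\<mu> = (\<Sum>d\<in>D. \<chi> d)"
proof -
  obtain vs v where vs: "distinct vs" "set vs = (UNIV :: 'a set)"
    and v: "eigenvector (adjacency_matrix (cayley_graph D) vs) v \<mu>"
    using assms by (auto simp: adjacency_eigenvalue_def eigenvalue_def cayley_graph_def)
  define n where "n = length vs"
  define A where "A = adjacency_matrix (cayley_graph D) vs"
  have A: "A \<in> carrier_mat n n" by (simp add: A_def adjacency_matrix_def n_def)
  have v': "v \<in> carrier_vec n" "v \<noteq> 0\<^sub>v n" "A *\<^sub>v v = \<mu> \<cdot>\<^sub>v v"
    using v A unfolding eigenvector_def A_def by auto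
  have b: "bij_betw ((!) vs) {..<n} UNIV"
    using bij_betw_nth[OF vs(1) _ refl] vs(2) by (auto simp: n_def)
  define ix where "ix = the_inv_into {..<n} ((!) vs)"
  have ix: "ix (vs ! i) = i" if "i < n" for i
    using that b by (auto simp: ix_def bij_betw_def the_inv_into_f_f)
  have vs_ix: "ix x < n" "vs ! ix x = x" for x
  proof -
    obtain i where "i < n" "vs ! i = x" using vs(2) by (metis UNIV_I in_set_conv_nth n_def)
    thus "ix x < n" "vs ! ix x = x" using ix by auto
  qed
  define f where "f x = v $ ix x" for x
  have "(\<Sum>d\<in>D. f (x + d)) = \<mu> * f x" for x
  proof -
    have "\<mu> * f x = (A *\<^sub>v v) $ ix x"
      using v' vs_ix by (simp add: f_def)
    also have "\<dots> = (\<Sum>j<n. A $$ (ix x, j) * v $ j)"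
      using v'(1) vs_ix(1) A by (simp add: scalar_prod_def atLeast0LessThan)
    also have "\<dots> = (\<Sum>j<n. if vs ! j - x \<in> D then f (vs ! j) else 0)"
      using vs_ix by (intro sum.cong)
        (auto simp: A_def adjacency_matrix_def cayley_graph_def f_def ix n_def)
    also have "\<dots> = (\<Sum>y\<in>UNIV. if y - x \<in> D then f y else 0)"
      by (rule sum.reindex_bij_betw[OF b])
    also have "\<dots> = (\<Sum>y | y - x \<in> D. f y)"
      by (simp add: sum.If_cases)
    also have "\<dots> = (\<Sum>d\<in>D. f (x + d))"
      by (rule sum.reindex_bij_witness[of _ "\<lambda>d. x + d" "\<lambda>y. y - x"]) auto
    finally show ?thesis by simp
  qed
  moreover obtain i where "i < n" "v $ i \<noteq> 0"
    using v' by (metis carrier_vecD dim_vec eq_vecI index_zero_vec)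
  hence "f (vs ! i) \<noteq> 0" by (simp add: f_def ix)
  ultimately show ?thesis
    using character_sum_of_eigenfunction[of f _ D \<mu>] that by blast
qed

section \<open>Roots of unity in finite fields\<close>

lemma finite_field_power_card_minus_one:
  fixes x :: "'a::{field, finite}"
  assumes "x \<noteq> 0"
  shows "x ^ (card (UNIV :: 'a set) - 1) = 1"
proof -
  have "(\<Prod>y\<in>UNIV - {0}. x * y) = (\<Prod>y\<in>UNIV - {0}. y)"
    by (rule prod.reindex_bij_witness[of _ "\<lambda>y. y / x" "\<lambda>y. x * y"]) (use assms in auto)
  moreover have "(\<Prod>y\<in>UNIV - {0 :: 'a}. y) \<noteq> 0" by simp
  ultimately show ?thesis by (simp add: prod.distrib)
qed

lemma card_roots_of_unity_finite_field:
  assumes "d dvd card (UNIV :: 'a::{field, finite} set) - 1"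
  shows "card {x :: 'a. x ^ d = 1} = d"
proof -
  define n where "n = card (UNIV :: 'a set) - 1"
  have "card {0, 1 :: 'a} \<le> card (UNIV :: 'a set)" by (intro card_mono) auto
  hence n: "n > 0" by (simp add: n_def)
  have deg: "degree (monom 1 k - 1 :: 'a poly) = k" for k
  proof (cases "k = 0")
    case False
    have "degree (monom 1 k + (- 1) :: 'a poly) = k"
      using False by (subst degree_add_eq_left) (auto simp: degree_monom_eq)
    thus ?thesis by simp
  qed (auto simp: one_pCons monom_0)
  have pol: "poly (monom 1 k - 1) x = x ^ k - (1 :: 'a)" for k x
    by (simp add: poly_monom)
  obtain e where e: "n = d * e" using assms by (auto simp: n_def)
  have d: "d > 0" "e > 0" using e n by (auto intro: Nat.gr0I)
  \<comment> \<open>\<open>P * R = X ^ n - 1\<close> has \<open>n\<close> roots, so neither factor can have fewer roots than its degree.\<close>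
  define P where "P = (monom 1 d - 1 :: 'a poly)"
  define R where "R = (\<Sum>i<e. monom 1 (d * i) :: 'a poly)"
  have PR: "P * R = monom 1 n - 1"
  proof -
    have "R = (\<Sum>i<e. monom 1 d ^ i)"
      by (simp add: R_def monom_power)
    thus ?thesis
      using power_diff_1_eq[of "monom 1 d :: 'a poly" e] by (simp add: P_def e monom_power)
  qed
  have nz: "P * R \<noteq> 0" unfolding PR using deg[of n] n by auto
  have "degree P + degree R = n"
    using nz degree_mult_eq[of P R] deg[of n] unfolding PR[symmetric] by auto
  moreover have "{x. poly P x = 0} \<union> {x. poly R x = 0} = UNIV - {0}"
  proof -
    have "poly P x = 0 \<or> poly R x = 0 \<longleftrightarrow> x ^ n = 1" for x
      using pol[of n x] PR by (metis mult_eq_0_iff poly_mult right_minus_eq)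
    moreover have "x ^ n = 1 \<longleftrightarrow> x \<noteq> 0" for x :: 'a
      using finite_field_power_card_minus_one[of x] n by (auto simp: n_def power_0_left)
    ultimately show ?thesis by auto
  qed
  hence "n \<le> card {x. poly P x = 0} + card {x. poly R x = 0}"
    using card_Un_le[of "{x. poly P x = 0}" "{x. poly R x = 0}"] by (simp add: n_def)
  moreover have "card {x. poly P x = 0} \<le> degree P" "card {x. poly R x = 0} \<le> degree R"
    using nz by (auto intro!: card_poly_roots_bound)
  ultimately have "card {x. poly P x = 0} = degree P" by linarith
  thus ?thesis using deg[of d] by (simp add: P_def poly_monom)
qed

lemma card_power_fixed_points_le:
  assumes "k \<ge> 2"
  shows "card {x :: 'a::{field, finite}. x ^ k = x} \<le> k"
proof -
  define P where "P = (monom 1 k - monom 1 1 :: 'a poly)"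
  have "coeff P k = 1" using assms by (simp add: P_def)
  hence "P \<noteq> 0" by auto
  moreover have "degree P \<le> k"
    using assms unfolding P_def by (intro degree_diff_le) (auto intro: order.trans[OF degree_monom_le])
  moreover have "{x :: 'a. x ^ k = x} = {x. poly P x = 0}"
    by (simp add: P_def poly_monom)
  ultimately show ?thesis using card_poly_roots_bound[of P] by simp
qed

section \<open>The Hermitian character sum\<close>

lemma hermitian_character_sum_bound:
  fixes \<chi> :: "'a::{field, finite} \<Rightarrow> complex"
  assumes "additive_character \<chi>" and nontriv: "\<chi> y0 \<noteq> 1"
    and Q: "Q \<ge> 2" and frob: "\<And>x y :: 'a. (x + y) ^ Q = x ^ Q + y ^ Q"
  shows "(cmod (\<Sum>z\<in>UNIV. \<chi> (z ^ (Q + 1))))\<^sup>2 \<le> real (card (UNIV :: 'a set)) * real Q ^ 2"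
proof -
  interpret additive_character \<chi> by fact
  define \<theta> where "\<theta> = (\<Sum>z\<in>UNIV. \<chi> (z ^ (Q + 1)))"
  define n where "n = card (UNIV :: 'a set)"
  define K where "K = {h :: 'a. \<forall>w. \<chi> (w ^ Q * h + w * h ^ Q) = 1}"
  \<comment> \<open>By \<open>frob\<close>, equal powers give \<open>(x - y) ^ Q = 0\<close>. In a
    finite field injectivity yields surjectivity, which supplies the \<open>Q\<close>-th root
    \<open>s\<close> below.\<close>
  have inj: "inj (\<lambda>x :: 'a. x ^ Q)"
  proof (rule injI)
    fix x y :: 'a assume "x ^ Q = y ^ Q"
    with frob[of y "x - y"] show "x = y" by simp
  qed
  have cardK: "card K \<le> Q ^ 2"
  proof (cases "K \<subseteq> {0}")
    case True
    hence "card K \<le> card {0 :: 'a}" by (intro card_mono) auto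
    also have "\<dots> \<le> Q ^ 2" using one_le_power[of Q 2] Q by simp
    finally show ?thesis .
  next
    case False
    then obtain h0 where h0: "h0 \<in> K" "h0 \<noteq> 0" by auto
    \<comment> \<open>Two nonzero elements of \<open>K\<close> differ by a factor in the field of order \<open>Q\<^sup>2\<close>.\<close>
    have "K \<subseteq> (\<lambda>s. h0 * s ^ Q) ` {s. s ^ (Q ^ 2) = s}"
    proof
      fix h assume h: "h \<in> K"
      obtain s where s: "h / h0 = s ^ Q"
        using finite_UNIV_inj_surj[OF finite inj] by (metis surjD)
      have hs: "h = h0 * s ^ Q" using s h0 by (simp add: field_simps)
      have "s ^ (Q ^ 2) = s"
      proof (rule ccontr)
        assume ne: "s ^ (Q ^ 2) \<noteq> s"
        \<comment> \<open>Testing \<open>h\<close> at \<open>w\<close> and \<open>h0\<close> at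
          \<open>w * s\<close> produces the same term \<open>w ^ Q * h\<close>, so the difference is
          \<open>w * a\<close>. If \<open>a\<close> is nonzero, \<open>w * a\<close> runs over the
          whole field and \<chi> would be trivial.\<close>
        define a where "a = h0 ^ Q * (s ^ (Q ^ 2) - s)"
        have a: "a \<noteq> 0" using ne h0 by (simp add: a_def)
        have "\<chi> (w * a) = 1" for w
        proof -
          have "w * a = (w ^ Q * h + w * h ^ Q) - ((w * s) ^ Q * h0 + (w * s) * h0 ^ Q)"
            by (simp add: a_def hs power_mult_distrib algebra_simps power2_eq_square power_mult)
          thus ?thesis using h h0(1) by (simp add: diff K_def)
        qed
        from this[of "y0 / a"] show False using nontriv a by simp
      qed
      thus "h \<in> (\<lambda>s. h0 * s ^ Q) ` {s. s ^ (Q ^ 2) = s}" using hs by auto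
    qed
    hence "card K \<le> card {s :: 'a. s ^ (Q ^ 2) = s}"
      by (rule surj_card_le[rotated]) simp
    also have "\<dots> \<le> Q ^ 2"
      using Q self_le_power[of Q 2] by (intro card_power_fixed_points_le) simp
    finally show ?thesis .
  qed
  \<comment> \<open>For fixed \<open>h\<close> the argument is additive in \<open>w\<close> by
    \<open>frob\<close>, so the summand is a character of \<open>w\<close>, trivial exactly when
    \<open>h\<close> is in \<open>K\<close>.\<close>
  have inner: "(\<Sum>w\<in>UNIV. \<chi> (w ^ Q * h + w * h ^ Q)) = (if h \<in> K then of_nat n else 0)" for h
  proof (cases "h \<in> K")
    case True
    thus ?thesis by (simp add: K_def n_def)
  next
    case False
    then obtain w where "\<chi> (w ^ Q * h + w * h ^ Q) \<noteq> 1" by (auto simp: K_def)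
    moreover have "additive_character (\<lambda>w. \<chi> (w ^ Q * h + w * h ^ Q))"
      by (rule additive_character_comp) (fact, simp add: frob algebra_simps)
    ultimately show ?thesis using False by (simp add: additive_character.sum_eq_0)
  qed
  have "complex_of_real ((cmod \<theta>)\<^sup>2) = \<theta> * cnj \<theta>"
    by (rule complex_norm_square)
  also have "\<dots> = (\<Sum>w\<in>UNIV. \<Sum>z\<in>UNIV. \<chi> (z ^ (Q + 1) - w ^ (Q + 1)))"
    unfolding \<theta>_def cnj_sum sum_product by (subst sum.swap) (simp only: diff)
  also have "\<dots> = (\<Sum>w\<in>UNIV. \<Sum>h\<in>UNIV. \<chi> ((w + h) ^ (Q + 1) - w ^ (Q + 1)))"
  proof (rule sum.cong[OF refl])
    fix w :: 'a
    show "(\<Sum>z\<in>UNIV. \<chi> (z ^ (Q + 1) - w ^ (Q + 1))) =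
        (\<Sum>h\<in>UNIV. \<chi> ((w + h) ^ (Q + 1) - w ^ (Q + 1)))"
      by (rule sum.reindex_bij_witness[of _ "\<lambda>h. w + h" "\<lambda>z. z - w"]) auto
  qed
  \<comment> \<open>After expansion with \<open>frob\<close>, subtracting \<open>w ^ (Q + 1)\<close>
    leaves \<open>h ^ (Q + 1)\<close> and the two cross terms.\<close>
  also have "\<dots> = (\<Sum>w\<in>UNIV. \<Sum>h\<in>UNIV. \<chi> (h ^ (Q + 1)) * \<chi> (w ^ Q * h + w * h ^ Q))"
    by (intro sum.cong refl) (simp add: frob algebra_simps flip: add)
  also have "\<dots> = (\<Sum>h\<in>UNIV. \<chi> (h ^ (Q + 1)) * (if h \<in> K then of_nat n else 0))"
    by (subst sum.swap) (simp only: flip: sum_distrib_left inner)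
  also have "\<dots> = (\<Sum>h\<in>K. \<chi> (h ^ (Q + 1)) * of_nat n)"
    by (simp add: if_distrib sum.If_cases cong: if_cong)
  finally have "(cmod \<theta>)\<^sup>2 = cmod (\<Sum>h\<in>K. \<chi> (h ^ (Q + 1)) * of_nat n)"
    by (metis norm_of_real abs_power2 abs_of_nonneg zero_le_power2)
  also have "\<dots> \<le> (\<Sum>h\<in>K. real n)"
    by (rule sum_norm_le) (simp add: norm_mult del: power_Suc)
  also have "\<dots> = real n * real (card K)" by simp
  also have "\<dots> \<le> real n * real (Q ^ 2)"
    using cardK by (intro mult_left_mono of_nat_mono) auto
  finally show ?thesis by (simp add: \<theta>_def n_def)
qed

section \<open>Additivity of Frobenius powers; power maps on the multiplicative group\<close>

lemma frobenius_power_add: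
  fixes x y :: "'a::{field, finite}"
  assumes "primepow q" and "card (UNIV :: 'a set) = q ^ m"
  shows "(x + y) ^ (q ^ l) = x ^ (q ^ l) + y ^ (q ^ l)"
proof -
  obtain p k where p: "prime p" "q = p ^ k" using assms(1) by (auto simp: primepow_def)
  have pr: "prime CHAR('a)"
    by (intro prime_CHAR_semidom finite_imp_CHAR_pos) auto
  \<comment> \<open>The order of the additive group annihilates 1, so the characteristic divides a
    power of \<open>p\<close> and must equal \<open>p\<close>.\<close>
  have "of_nat (card (UNIV :: 'a set)) = (0 :: 'a)"
    using sum_const_card_eq_zero[of "1 :: 'a"] by simp
  hence "CHAR('a) dvd (p ^ k) ^ m"
    by (simp only: of_nat_eq_0_iff_char_dvd assms(2) p(2))
  hence "CHAR('a) dvd p"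
    using pr by (blast dest: prime_dvd_power)
  hence "CHAR('a) = p"
    using p(1) pr by (simp add: primes_dvd_imp_eq)
  thus ?thesis
    by (intro freshmans_dream'[OF pr, of _ "k * l"]) (simp add: p(2) power_mult)
qed

lemma minus_one_dvd_power_minus_one:
  fixes a :: nat
  assumes "a \<ge> 1"
  shows "a - 1 dvd a ^ t - 1"
proof -
  have "int (a - 1) dvd int (a ^ t - 1)"
    using assms power_diff_1_eq[of "int a" t] by (simp add: of_nat_diff)
  thus ?thesis by (simp only: int_dvd_int_iff)
qed

text \<open>This makes the set of nonzero \<open>(Q + 1)\<close>-th powers closed under negation.
  For odd \<open>Q\<close>, \<open>(Q + 1) * 2\<close> divides the order of the multiplicative
  group, so some root of unity for this exponent is not one for \<open>Q + 1\<close>; its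
  \<open>(Q + 1)\<close>-th power is a square root of 1 other than 1.\<close>

lemma minus_one_power_residue:
  assumes "card (UNIV :: 'a::{field, finite} set) = (Q ^ 2) ^ t" and "Q \<ge> 2" and "t \<ge> 1"
  obtains u :: "'a::{field, finite}" where "u ^ (Q + 1) = - 1"
proof (cases "even Q")
  case True
  \<comment> \<open>With an odd exponent, \<open>(- 1) ^ (card UNIV - 1) = 1\<close> reads
    \<open>- 1 = 1\<close>.\<close>
  have "odd (card (UNIV :: 'a set) - 1)"
    using True assms by (simp add: power_0_left)
  hence "(1 :: 'a) ^ (Q + 1) = - 1"
    using finite_field_power_card_minus_one[of "- 1 :: 'a"] by simp
  thus ?thesis by (rule that)
next
  case False
  define d where "d = Q + 1"
  have sq: "Q ^ 2 - 1 = d * (Q - 1)"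
    by (simp add: d_def power2_eq_square algebra_simps)
  have "d * 2 dvd Q ^ 2 - 1"
    unfolding sq using False by (intro mult_dvd_mono) auto
  also have "\<dots> dvd card (UNIV :: 'a set) - 1"
    unfolding assms(1) using assms(2) by (intro minus_one_dvd_power_minus_one) simp
  finally have dvd: "d * 2 dvd card (UNIV :: 'a set) - 1" .
  hence "card {x :: 'a. x ^ (d * 2) = 1} = d * 2" "card {x :: 'a. x ^ d = 1} = d"
    using card_roots_of_unity_finite_field[OF dvd]
      card_roots_of_unity_finite_field[OF dvd_mult_left[OF dvd]] by auto
  moreover have "d > 0" by (simp add: d_def)
  ultimately have "\<not> {x :: 'a. x ^ (d * 2) = 1} \<subseteq> {x. x ^ d = 1}"
    using card_mono[of "{x :: 'a. x ^ d = 1}" "{x :: 'a. x ^ (d * 2) = 1}"] by auto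
  then obtain u :: 'a where "(u ^ d) ^ 2 = 1" "u ^ d \<noteq> 1"
    by (auto simp: power_mult)
  hence "u ^ (Q + 1) = - 1" by (auto simp: power2_eq_1_iff d_def)
  thus ?thesis by (rule that)
qed

text \<open>On nonzero elements the fibres of the \<open>d\<close>-th power map are cosets of the
  group of \<open>d\<close>-th roots of unity, which has \<open>d\<close> elements.\<close>

lemma sum_over_powers:
  fixes g :: "'a::{field, finite} \<Rightarrow> 'b::semiring_1"
  assumes "d dvd card (UNIV :: 'a set) - 1"
  shows "(\<Sum>x\<in>UNIV - {0}. g (x ^ d)) = of_nat d * (\<Sum>s\<in>{x ^ d | x. x \<noteq> 0}. g s)"
proof -
  have fibre: "card {x \<in> UNIV - {0}. x ^ d = y ^ d} = d" if "y \<noteq> 0" for y :: 'a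
  proof -
    have "bij_betw ((*) y) {x. x ^ d = 1} {x \<in> UNIV - {0}. x ^ d = y ^ d}"
    proof (cases "d = 0")
      \<comment> \<open>Here 0 would divide \<open>card UNIV - 1\<close>, which is positive because
        0 and 1 are distinct.\<close>
      case True
      have "card {0, 1 :: 'a} \<le> card (UNIV :: 'a set)" by (intro card_mono) auto
      thus ?thesis using True assms by simp
    next
      case False
      show ?thesis
        by (rule bij_betw_byWitness[of _ "\<lambda>x. x / y"])
          (use that False in \<open>auto simp: power_mult_distrib power_divide power_0_left\<close>)
    qed
    thus ?thesis
      using card_roots_of_unity_finite_field[OF assms] by (simp add: bij_betw_same_card)
  qed
  have "(\<Sum>x\<in>UNIV - {0}. g (x ^ d)) =
      (\<Sum>s\<in>(\<lambda>x. x ^ d) ` (UNIV - {0}). \<Sum>x | x \<in> UNIV - {0} \<and> x ^ d = s. g (x ^ d))"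
    by (rule sum.image_gen) simp
  also have "\<dots> = (\<Sum>s\<in>(\<lambda>x. x ^ d) ` (UNIV - {0}). of_nat d * g s)"
  proof (rule sum.cong[OF refl])
    fix s :: 'a assume "s \<in> (\<lambda>x. x ^ d) ` (UNIV - {0})"
    then obtain y where y: "y \<noteq> 0" "s = y ^ d" by auto
    have "(\<Sum>x | x \<in> UNIV - {0} \<and> x ^ d = s. g (x ^ d)) = (\<Sum>x | x \<in> UNIV - {0} \<and> x ^ d = s. g s)"
      by (rule sum.cong) auto
    also have "\<dots> = of_nat d * g s"
      using fibre[OF y(1)] y(2) by simp
    finally show "(\<Sum>x | x \<in> UNIV - {0} \<and> x ^ d = s. g (x ^ d)) = of_nat d * g s" .
  qed
  also have "(\<lambda>x :: 'a. x ^ d) ` (UNIV - {0}) = {x ^ d | x. x \<noteq> 0}" by auto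
  finally show ?thesis by (simp add: sum_distrib_left)
qed

section \<open>Regularity, symmetry and connectivity of Cayley graphs\<close>

lemma graph_complement_cayley_graph:
  "graph_complement (cayley_graph S) = cayley_graph {d. d \<noteq> 0 \<and> d \<notin> S}"
  by (auto simp: graph_complement_def cayley_graph_def)

lemma pair_graph_cayley_graph:
  fixes D :: "'a::{ab_group_add, finite} set"
  assumes "0 \<notin> D" and "\<And>d. d \<in> D \<Longrightarrow> - d \<in> D"
  shows "pair_graph (cayley_graph D)"
proof
  show "symmetric (with_proj (cayley_graph D))"
    using assms(2) by (auto simp: symmetric_def cayley_graph_def sym_def) (metis minus_diff_eq)
  show "finite (parcs (cayley_graph D))"
    by (rule finite_subset[of _ UNIV]) (auto intro: finite_Prod_UNIV)
qed (use assms(1) in \<open>auto simp: cayley_graph_def\<close>)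

lemma regular_graph_cayley_graph:
  fixes D :: "'a::{ab_group_add, finite} set"
  shows "regular_graph (cayley_graph D) (card D)"
  unfolding regular_graph_def
proof
  fix v :: 'a
  have "bij_betw (\<lambda>d. (v, v + d)) D (out_arcs (with_proj (cayley_graph D)) v)"
    by (rule bij_betw_byWitness[of _ "\<lambda>e. snd e - v"]) (auto simp: cayley_graph_def)
  thus "out_degree (with_proj (cayley_graph D)) v = card D"
    by (simp add: out_degree_def bij_betw_same_card)
qed

text \<open>The hypothesis provides a path of length at most two between any two vertices.\<close>

lemma connected_cayley_graph:
  fixes D :: "'a::{ab_group_add, finite} set"
  assumes "\<And>x. x \<noteq> 0 \<Longrightarrow> x \<in> D \<or> (\<exists>a\<in>D. x - a \<in> D)"
  shows "Digraph_Component.connected (with_proj (cayley_graph D))"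
proof -
  \<comment> \<open>Connectivity of a digraph is reachability along the symmetric closure of its
    arcs.\<close>
  define E where "E = {(x, y). y - x \<in> D}\<^sup>s"
  have E: "(x, y) \<in> E" if "y - x \<in> D" for x y
    using that by (auto simp: E_def symcl_def)
  have "(u, v) \<in> rtrancl_on UNIV E" for u v
  proof (cases "v - u = 0")
    case False
    from assms[OF this] show ?thesis
    proof
      assume "v - u \<in> D"
      hence "(u, v) \<in> E" by (rule E)
      thus ?thesis by (meson UNIV_I rtrancl_on.simps)
    next
      assume "\<exists>a\<in>D. v - u - a \<in> D"
      then obtain a where "a \<in> D" "v - u - a \<in> D" by blast
      hence "(u, u + a) \<in> E" "(u + a, v) \<in> E" by (auto intro!: E simp: algebra_simps)
      thus ?thesis by (meson UNIV_I rtrancl_on.simps)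
    qed
  qed auto
  thus ?thesis by (simp add: connected_conv E_def cayley_graph_def)
qed

text \<open>With \<open>y = Q ^ t\<close>, the left side bounds the squared modulus of a nontrivial
  eigenvalue, and \<open>Q * (y\<^sup>2 - 1) / (Q + 1)\<close> is the degree of the
  complement.\<close>

lemma complement_eigenvalue_bound_numeric:
  fixes Q y :: real
  assumes "Q \<ge> 2" and "y \<ge> Q"
  shows "(Q * (y + 1) / (Q + 1))\<^sup>2 \<le> 4 * (Q * (y\<^sup>2 - 1) / (Q + 1) - 1)"
proof -
  \<comment> \<open>In terms of \<open>a\<close> and \<open>b\<close>, the difference of the two sides has nonnegative coefficients.\<close>
  define a where "a = Q - 2"
  define b where "b = y - Q"
  have ab: "a \<ge> 0" "b \<ge> 0" "Q = a + 2" "y = a + b + 2"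
    using assms by (auto simp: a_def b_def)
  have "(Q * (y + 1))\<^sup>2 \<le> 4 * (Q * (y\<^sup>2 - 1) * (Q + 1) - (Q + 1)\<^sup>2)"
  proof -
    have "0 \<le> 4 * (Q * (y\<^sup>2 - 1) * (Q + 1) - (Q + 1)\<^sup>2) - (Q * (y + 1))\<^sup>2"
      using ab(1,2) unfolding ab(3,4)
      by (simp add: power2_eq_square algebra_simps)
    thus ?thesis by simp
  qed
  hence "(Q * (y + 1))\<^sup>2 / (Q + 1)\<^sup>2 \<le>
      4 * (Q * (y\<^sup>2 - 1) * (Q + 1) - (Q + 1)\<^sup>2) / (Q + 1)\<^sup>2"
    by (rule divide_right_mono) simp
  also have "\<dots> = 4 * (Q * (y\<^sup>2 - 1) / (Q + 1) - 1)"
    using assms(1) by (simp add: diff_divide_distrib power2_eq_square)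
  finally show ?thesis by (simp add: power_divide)
qed

section \<open>Degree, connectivity and spectrum of the complement\<close>

theorem theorem8p5:
  fixes q m l :: nat
  assumes "primepow q"
    and "card (UNIV :: 'a::{field, finite} set) = q ^ m"
    and "m \<ge> 2" and "l \<ge> 1" and "l dvd m" and "l < m" and "even (m div l)"
  shows "ramanujan_graph (graph_complement (Gamma_graph q l :: 'a pair_pre_digraph))"
proof -
  define Q where "Q = q ^ l"
  define t where "t = m div l div 2"
  define n where "n = card (UNIV :: 'a set)"
  define S where "S = (connection_set q l :: 'a set)"
  define D where "D = {d. d \<noteq> 0 \<and> d \<notin> S}"
  \<comment> \<open>\<open>y\<close> is the square root of the field order \<open>n\<close>, and
    \<open>y \<ge> Q\<close> because \<open>t \<ge> 1\<close>.\<close>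
  define y where "y = Q ^ t"
  have m: "m = l * (2 * t)" using assms(5,7) by (simp add: t_def)
  have n_eq: "n = (Q ^ 2) ^ t" by (simp add: n_def Q_def assms(2) m mult_ac flip: power_mult)
  have t: "t \<ge> 1" using m assms(3) by (cases t) auto
  have "q \<ge> 2" using primepow_gt_Suc_0[OF assms(1)] by simp
  hence Q: "Q \<ge> 2" using self_le_power[of q l] assms(4) by (simp add: Q_def)
  have y: "n = y ^ 2" "y \<ge> Q"
    using Q t self_le_power[of Q t] by (simp_all add: n_eq y_def mult.commute flip: power_mult)
  have n4: "n \<ge> 4" using power_mono[of 2 y 2] y Q by simp
  have S_def': "S = {x ^ (Q + 1) | x. x \<noteq> 0}"
    by (simp add: S_def connection_set_def Q_def)
  have "Q + 1 dvd Q ^ 2 - 1"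
    by (rule dvdI[of _ _ "Q - 1"]) (simp add: power2_eq_square algebra_simps)
  also have "Q ^ 2 - 1 dvd n - 1"
    unfolding n_eq using Q by (intro minus_one_dvd_power_minus_one) simp
  finally have dvd: "Q + 1 dvd card (UNIV :: 'a set) - 1" by (simp add: n_def)
  have cardS: "(Q + 1) * card S = n - 1"
    using sum_over_powers[OF dvd, of "\<lambda>_. 1 :: nat"] by (simp add: S_def' n_def)
  have S0: "0 \<notin> S" by (auto simp: S_def')
  \<comment> \<open>Multiplying a \<open>(Q + 1)\<close>-th root of \<open>s\<close> by
    \<open>u\<close> gives one of \<open>- s\<close>.\<close>
  obtain u :: 'a where u: "u ^ (Q + 1) = - 1"
    using minus_one_power_residue[of Q t] n_eq Q t by (auto simp: n_def)
  have uminus_S: "- s \<in> S" if s: "s \<in> S" for s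
  proof -
    obtain x where x: "x \<noteq> 0" "s = x ^ (Q + 1)" using s by (auto simp: S_def')
    have "- s = (u * x) ^ (Q + 1)" by (simp only: power_mult_distrib u x) simp
    moreover have "u * x \<noteq> 0" using u x(1) by (auto simp: power_0_left)
    ultimately show ?thesis unfolding S_def' by blast
  qed
  \<comment> \<open>This partition of the field is counted to find \<open>card D\<close> and later
    summed against \<chi>.\<close>
  have D_Un: "UNIV = insert 0 (S \<union> D)" "0 \<notin> S \<union> D" "S \<inter> D = {}"
    using S0 by (auto simp: D_def)
  have "card (insert 0 (S \<union> D)) = 1 + (card S + card D)"
    using D_Un(2,3) by (simp add: card_Un_disjoint)
  hence "n = 1 + (card S + card D)" by (simp only: n_def D_Un(1))
  hence cardD: "real (card D) = real Q * (real y ^ 2 - 1) / (real Q + 1)"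
  proof -
    have "(Q + 1) * card D + (n - 1) = (Q + 1) * (n - 1)"
      using \<open>n = 1 + (card S + card D)\<close> cardS by (simp add: algebra_simps)
    hence "real ((Q + 1) * card D + (n - 1)) = real ((Q + 1) * (n - 1))" by simp
    hence eq: "(real Q + 1) * real (card D) + real (n - 1) = (real Q + 1) * real (n - 1)"
      by (simp only: of_nat_add of_nat_mult of_nat_1)
    have "real (n - 1) = real y ^ 2 - 1"
      using n4 by (simp add: of_nat_diff flip: y(1))
    from eq[unfolded this] show ?thesis by (simp add: field_simps)
  qed
  have G: "graph_complement (Gamma_graph q l :: 'a pair_pre_digraph) = cayley_graph D"
    by (simp add: Gamma_graph_def graph_complement_cayley_graph D_def S_def)
  have D_minus: "- d \<in> D" if "d \<in> D" for d
    using that uminus_S[of "- d"] by (auto simp: D_def)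
  have conn: "x \<in> D \<or> (\<exists>a\<in>D. x - a \<in> D)" if x: "x \<noteq> 0" for x
  proof (rule ccontr)
    assume *: "\<not> ?thesis"
    hence xS: "x \<in> S" using x by (auto simp: D_def)
    \<comment> \<open>Without a common neighbour of \<open>0\<close> and \<open>x\<close>, the set \<open>S\<close> would be too large.\<close>
    have "UNIV \<subseteq> S \<union> (\<lambda>s. x + s) ` S"
    proof
      fix a :: 'a
      have "a \<in> S \<or> a - x \<in> S"
      proof (rule ccontr)
        assume a: "\<not> ?thesis"
        \<comment> \<open>If \<open>a = x\<close> then \<open>a\<close> lies in \<open>S\<close>; if
          \<open>a = 0\<close> then \<open>a - x = - x\<close> does. Hence \<open>a\<close> and
          \<open>x - a\<close> both lie in \<open>D\<close>, against \<open>*\<close>.\<close>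
        hence "a \<noteq> x" "a \<noteq> 0" using xS uminus_S[OF xS] by auto
        moreover have "x - a \<notin> S" using a uminus_S[of "x - a"] by auto
        ultimately show False using * a by (auto simp: D_def)
      qed
      thus "a \<in> S \<union> (\<lambda>s. x + s) ` S" by (auto intro: image_eqI[of _ _ "a - x"])
    qed
    hence "n \<le> card (S \<union> (\<lambda>s. x + s) ` S)" unfolding n_def by (intro card_mono) auto
    also have "\<dots> \<le> card S + card S"
      by (rule order.trans[OF card_Un_le]) (simp add: card_image_le)
    also have "\<dots> \<le> (Q + 1) * card S" using Q by simp
    also have "\<dots> = n - 1" by (rule cardS)
    finally show False using n4 by simp
  qed
  have bound: "cmod \<mu> \<le> 2 * sqrt (real (card D) - 1)"
    if \<mu>: "adjacency_eigenvalue (cayley_graph D) \<mu>" "cmod \<mu> \<noteq> real (card D)" for \<mu>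
  proof -
    obtain \<chi> where \<chi>: "additive_character \<chi>" "\<mu> = (\<Sum>d\<in>D. \<chi> d)"
      using cayley_graph_eigenvalue[OF \<mu>(1)] .
    interpret additive_character \<chi> by fact
    \<comment> \<open>For the trivial character \<mu> would be \<open>card D\<close>, which the
      assumption on \<mu> excludes.\<close>
    obtain y0 where y0: "\<chi> y0 \<noteq> 1" using \<mu>(2) \<chi>(2) by force
    define \<theta> where "\<theta> = (\<Sum>z\<in>UNIV. \<chi> (z ^ (Q + 1)))"
    have "(cmod \<theta>)\<^sup>2 \<le> real n * real Q ^ 2"
      unfolding \<theta>_def n_def
      by (rule hermitian_character_sum_bound[OF \<chi>(1) y0 Q])
        (simp add: Q_def frobenius_power_add[OF assms(1,2)])
    also have "\<dots> = (real y * real Q)\<^sup>2" by (simp add: y(1) power_mult_distrib)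
    finally have \<theta>: "cmod \<theta> \<le> real y * real Q" by (rule power2_le_imp_le) simp
    \<comment> \<open>The term at \<open>z = 0\<close> is 1, and the other terms cover
      \<open>S\<close> with multiplicity \<open>Q + 1\<close>.\<close>
    have "\<theta> = 1 + (\<Sum>z\<in>UNIV - {0}. \<chi> (z ^ (Q + 1)))"
      unfolding \<theta>_def by (subst sum.remove[of _ 0]) auto
    also have "\<dots> = 1 + (of_nat Q + 1) * (\<Sum>s\<in>S. \<chi> s)"
      by (subst sum_over_powers[OF dvd]) (simp add: S_def' add.commute)
    finally have \<theta>_eq: "\<theta> = 1 + (of_nat Q + 1) * (\<Sum>s\<in>S. \<chi> s)" .
    have "(\<Sum>x\<in>insert 0 (S \<union> D). \<chi> x) = 1 + ((\<Sum>s\<in>S. \<chi> s) + \<mu>)"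
      unfolding \<chi>(2) using D_Un(2,3) by (simp add: sum.union_disjoint)
    hence "(\<Sum>x\<in>UNIV. \<chi> x) = 1 + ((\<Sum>s\<in>S. \<chi> s) + \<mu>)" by (simp only: D_Un(1))
    hence "1 + ((\<Sum>s\<in>S. \<chi> s) + \<mu>) = 0" using sum_eq_0[OF y0] by simp
    \<comment> \<open>The sum over \<open>S\<close> is eliminated between \<theta> and the vanishing
      total character sum.\<close>
    moreover have "(of_nat Q + 1) * \<mu> + (of_nat Q + \<theta>) =
        (of_nat Q + 1) * (1 + ((\<Sum>s\<in>S. \<chi> s) + \<mu>))"
      by (simp add: \<theta>_eq algebra_simps)
    ultimately have "(of_nat Q + 1) * \<mu> = - (of_nat Q + \<theta>)"
      by (simp only: mult_zero_right eq_neg_iff_add_eq_0)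
    hence "cmod ((of_nat Q + 1) * \<mu>) = cmod (of_nat Q + \<theta>)"
      by (simp only: norm_minus_cancel)
    also have "\<dots> \<le> real Q + real y * real Q"
      by (rule order.trans[OF norm_triangle_ineq]) (simp add: \<theta>)
    also have "cmod ((of_nat Q + 1) * \<mu>) = (real Q + 1) * cmod \<mu>"
      by (metis norm_mult norm_of_nat of_nat_Suc add.commute)
    finally have "cmod \<mu> \<le> real Q * (real y + 1) / (real Q + 1)"
      by (simp add: field_simps)
    hence "(cmod \<mu>)\<^sup>2 \<le> (real Q * (real y + 1) / (real Q + 1))\<^sup>2"
      by (rule power_mono) simp
    also have "\<dots> \<le> 4 * (real (card D) - 1)"
      unfolding cardD using Q y(2) by (intro complement_eigenvalue_bound_numeric) auto
    finally have "(cmod \<mu>)\<^sup>2 \<le> 4 * (real (card D) - 1)" .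
    hence "cmod \<mu> \<le> sqrt (4 * (real (card D) - 1))" by (rule real_le_rsqrt)
    thus ?thesis by (simp only: real_sqrt_mult real_sqrt_four)
  qed
  show ?thesis
    unfolding ramanujan_graph_def G
    using pair_graph_cayley_graph[OF _ D_minus] connected_cayley_graph[OF conn]
      regular_graph_cayley_graph[of D] bound
    by (auto simp: D_def)
qed

end
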